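(* Let $F_k:\mathbb{R}^n\to\mathcal{I}$ ($k\in K:=\{1,\dots,m\}$) and $g_j:\mathbb{R}^n\to\mathbb{R}$ ($j\in J:=\{1,\dots,p\}$) be locally Lipschitz continuous, $S:=\{u\in\mathbb{R}^n:g_j(u)\le0,\ \forall j\in J\}$. Let $\overline{u}\in S$ be a locally weak minimal solution of the problem of minimizing $F=(F_1,\dots,F_m)$ over $S$, and suppose that BCQ holds on a neighbourhood of $\overline{u}$ (i.e. at every point of $S$ in some neighbourhood of $\overline u$). Suppose that $\epsilon_i>0$ for $i=1,2,\dots$ with $\epsilon_i\to0$. Then for any sequence $\{x_i\}$ in $S$ with $x_i\to\overline{u}$ as $i\to+\infty$, there is a subsequence $\{z_i\}$ of $\{x_i\}$ such that for every $z_i$ there is $y_i\in S$ satisfying: (i) $\|z_i-y_i\|\leq\sqrt{\epsilon_i}$; (ii) there exist $u_k^i\in\partial^0F_k(y_i)$ for all $k\in K$, $v_j^i\in\partial^0g_j(y_i)$ for all $j\in J$, $\lambda^i=(\lambda_1^i,\dots,\lambda_m^i)\in\mathbb{R}_+^m$ with $\sum_{k\in K}\lambda_k^i=1$, and $\mu^i=(\mu_1^i,\dots,\mu_p^i)\in\mathbb{R}_+^p$ such that $$\Big\|\sum_{k\in K}\lambda_k^i u_k^i+\sum_{j\in J}\mu_j^iv_j^i\Big\|\leq\sqrt{\epsilon_i},\qquad \sum_{j\in J}\mu_j^ig_j(y_i)=0.$$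
   Context: $\mathcal{I}$ is the set of all compact intervals $[\underline q,\overline q]$ with $\underline q\le\overline q$ real. For $Q=[\underline q,\overline q]\in\mathcal I$ put $q^c=\frac{\underline q+\overline q}{2}$ and $q^w=\frac{\overline q-\underline q}{2}$. Order: $Q\prec_{CW}R$ iff $q^c<r^c$ and $q^w<r^w$. $\mathbb{R}^m_+$ is the nonnegative orthant; $\mathrm{co}$ denotes convex hull. An interval-valued function $f=[\underline f,\overline f]:\mathbb{R}^n\to\mathcal I$ is locally Lipschitz continuous if every point has a neighbourhood $U$ and $L>0$ with $\max\{|\underline f(u_1)-\underline f(u_2)|,|\overline f(u_1)-\overline f(u_2)|\}\le L\|u_1-u_2\|$ for $u_1,u_2\in U$ (equivalently, $\underline f,\overline f$ are locally Lipschitz). Write $f^c=\frac{\underline f+\overline f}{2}$, $f^w=\frac{\overline f-\underline f}{2}$. For locally Lipschitz $\psi:\mathbb{R}^n\to\mathbb{R}$, $\psi^0(z;w)=\limsup_{u\to z,\,t\to0^+}\frac{\psi(u+tw)-\psi(u)}{t}$ and $\partial^0\psi(z)=\{z^*\in\mathbb{R}^n:\langle z^*,w\rangle\le\psi^0(z;w)\ \forall w\}$ (Clarke gradient). For a locally Lipschitz interval-valued $f$, the weakly generalized gradient is $\partial^0f(u):=\mathrm{co}(\partial^0f^c(u)\cup\partial^0f^w(u))$. $z_0\in S$ is a locally weak minimal solution if there is a neighbourhood $U(z_0)$ of $z_0$ such that there is no $z\in S\cap U(z_0)$ with $F_k(z)\prec_{CW}F_k(z_0)$ for all $k\in K$.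 For $u\in S$, $I(u):=\{j\in J:g_j(u)=0\}$. BCQ holds at $u\in S$ if there is no $\mu\in\mathbb{R}^p_+\setminus\{0\}$ with $\mu_j\ge 0$ for $j\in I(u)$, $\mu_j=0$ for $j\notin I(u)$ and $0\in\sum_{j\in J}\mu_j\partial^0g_j(u)$. *)

theory Defs
  imports "HOL-Analysis.Analysis" "HOL-Library.Interval"
begin

definition center :: "real interval \<Rightarrow> real" where
  "center Q = (lower Q + upper Q) / 2"

text \<open>The half-width; the library constant \<open>width\<close> is twice this.\<close>

definition halfwidth :: "real interval \<Rightarrow> real" where
  "halfwidth Q = (upper Q - lower Q) / 2"

definition less_CW :: "real interval \<Rightarrow> real interval \<Rightarrow> bool"  (infix \<open>\<prec>\<^sub>C\<^sub>W\<close> 50) where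
  "Q \<prec>\<^sub>C\<^sub>W R \<longleftrightarrow> center Q < center R \<and> halfwidth Q < halfwidth R"

definition locally_lipschitz :: "('a::real_normed_vector \<Rightarrow> real) \<Rightarrow> bool" where
  "locally_lipschitz \<psi> \<longleftrightarrow>
     (\<forall>x. \<exists>U L. open U \<and> x \<in> U \<and> L > 0 \<and>
        (\<forall>u1\<in>U. \<forall>u2\<in>U. \<bar>\<psi> u1 - \<psi> u2\<bar> \<le> L * norm (u1 - u2)))"

definition locally_lipschitz_interval :: "('a::real_normed_vector \<Rightarrow> real interval) \<Rightarrow> bool" where
  "locally_lipschitz_interval f \<longleftrightarrow>
     (\<forall>x. \<exists>U L. open U \<and> x \<in> U \<and> L > 0 \<and>
        (\<forall>u1\<in>U. \<forall>u2\<in>U.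
           max \<bar>lower (f u1) - lower (f u2)\<bar> \<bar>upper (f u1) - upper (f u2)\<bar> \<le> L * norm (u1 - u2)))"

text \<open>
  The limes superior over \<open>u \<rightarrow> z\<close> (with \<open>u = z\<close> allowed) and \<open>t \<rightarrow> 0+\<close> is taken in the
  extended reals, where it always exists; it is finite for locally Lipschitz functions.
\<close>

definition clarke_dir_deriv :: "('a::real_normed_vector \<Rightarrow> real) \<Rightarrow> 'a \<Rightarrow> 'a \<Rightarrow> ereal" where
  "clarke_dir_deriv \<psi> z w =
     Limsup (nhds z \<times>\<^sub>F at_right 0) (\<lambda>(u, t). ereal ((\<psi> (u + t *\<^sub>R w) - \<psi> u) / t))"

definition clarke_gradient :: "('a::real_inner \<Rightarrow> real) \<Rightarrow> 'a \<Rightarrow> 'a set" where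
  "clarke_gradient \<psi> z = {zs. \<forall>w. ereal (zs \<bullet> w) \<le> clarke_dir_deriv \<psi> z w}"

definition weak_gen_gradient :: "('a::real_inner \<Rightarrow> real interval) \<Rightarrow> 'a \<Rightarrow> 'a set" where
  "weak_gen_gradient f u =
     convex hull (clarke_gradient (\<lambda>x. center (f x)) u \<union> clarke_gradient (\<lambda>x. halfwidth (f x)) u)"

text \<open>
  Finite families indexed by \<open>{1..m}\<close> or \<open>{1..p}\<close>, including vectors of multipliers, are
  functions on \<open>nat\<close> of which only the values at these indices matter.
\<close>

definition feasible_set :: "nat \<Rightarrow> (nat \<Rightarrow> 'a \<Rightarrow> real) \<Rightarrow> 'a set" where
  "feasible_set p g = {u. \<forall>j\<in>{1..p}. g j u \<le> 0}"

definition locally_weak_minimal ::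
    "nat \<Rightarrow> (nat \<Rightarrow> 'a::topological_space \<Rightarrow> real interval) \<Rightarrow> 'a set \<Rightarrow> 'a \<Rightarrow> bool" where
  "locally_weak_minimal m F S z0 \<longleftrightarrow>
     z0 \<in> S \<and>
     (\<exists>U. open U \<and> z0 \<in> U \<and> \<not> (\<exists>z\<in>S \<inter> U. \<forall>k\<in>{1..m}. F k z \<prec>\<^sub>C\<^sub>W F k z0))"

definition active_set :: "nat \<Rightarrow> (nat \<Rightarrow> 'a \<Rightarrow> real) \<Rightarrow> 'a \<Rightarrow> nat set" where
  "active_set p g u = {j\<in>{1..p}. g j u = 0}"

text \<open>The sum over \<open>j\<close> below is the Minkowski sum of sets.\<close>

definition BCQ :: "nat \<Rightarrow> (nat \<Rightarrow> 'a::real_inner \<Rightarrow> real) \<Rightarrow> 'a \<Rightarrow> bool" where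
  "BCQ p g u \<longleftrightarrow>
     \<not> (\<exists>\<mu> :: nat \<Rightarrow> real.
          (\<exists>j\<in>{1..p}. \<mu> j \<noteq> 0) \<and>
          (\<forall>j\<in>active_set p g u. \<mu> j \<ge> 0) \<and>
          (\<forall>j\<in>{1..p} - active_set p g u. \<mu> j = 0) \<and>
          0 \<in> (\<Sum>j\<in>{1..p}. (\<lambda>v. \<mu> j *\<^sub>R v) ` clarke_gradient (g j) u))"

end

(*
  The approximating points can all be taken equal to ubar, because ubar itself satisfies the exact
  multiplier rule.  If all centre and half-width functions and all active constraints had a negative
  Clarke derivative at ubar in a common direction, a small step in that direction would stay feasible
  and strictly improve every objective.  As the Clarke derivative is the support function of the
  Clarke gradient, separating 0 from the compact convex hull of these gradients is therefore
  impossible, so 0 lies in the hull.  BCQ at ubar makes the total weight of the objectives nonzero,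
  and dividing by it normalises the multipliers.
*)

theory Submission
  imports Defs
begin

section \<open>Calculus of the Clarke directional derivative\<close>

lemma nhds_at_right_neq_bot: "nhds z \<times>\<^sub>F at_right (0::real) \<noteq> bot"
  by (simp add: prod_filter_eq_bot)

lemma clarke_dir_deriv_lessD:
  assumes "clarke_dir_deriv \<psi> z w < ereal c"
  shows "\<forall>\<^sub>F (u, t) in nhds z \<times>\<^sub>F at_right 0. (\<psi> (u + t *\<^sub>R w) - \<psi> u) / t < c"
  using Limsup_lessD[OF assms[unfolded clarke_dir_deriv_def]]
  by (simp add: case_prod_unfold)

lemma clarke_dir_deriv_le:
  assumes "\<forall>\<^sub>F (u, t) in nhds z \<times>\<^sub>F at_right 0. (\<psi> (u + t *\<^sub>R w) - \<psi> u) / t \<le> c"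
  shows "clarke_dir_deriv \<psi> z w \<le> ereal c"
  unfolding clarke_dir_deriv_def
  by (rule Limsup_bounded) (use assms in \<open>simp add: case_prod_unfold\<close>)

text \<open>Both ends of the difference quotient approach \<open>z\<close>, so local estimates
  around \<open>z\<close> apply to them, and \<open>u + t *\<^sub>R w\<close> may itself serve as a
  moving base point.\<close>

lemma filterlim_clarke_base:
  fixes z w :: "'a::real_normed_vector"
  shows "((\<lambda>(u, t). u + t *\<^sub>R w) \<longlongrightarrow> z) (nhds z \<times>\<^sub>F at_right (0::real))"
proof -
  have 1: "((\<lambda>x. fst x) \<longlongrightarrow> z) (nhds z \<times>\<^sub>F at_right (0::real))"
    by (rule filterlim_fst)
  have 2: "((\<lambda>x. snd x) \<longlongrightarrow> 0) (nhds z \<times>\<^sub>F at_right (0::real))"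
    by (rule filterlim_mono[OF filterlim_snd _ order_refl]) (simp add: at_within_le_nhds)
  have "((\<lambda>x. fst x + snd x *\<^sub>R w) \<longlongrightarrow> z + 0 *\<^sub>R w) (nhds z \<times>\<^sub>F at_right (0::real))"
    by (intro tendsto_intros 1 2)
  then show ?thesis
    by (simp add: case_prod_unfold)
qed

lemma eventually_clarke_pos: "\<forall>\<^sub>F (u, t) in nhds z \<times>\<^sub>F at_right (0::real). t > 0"
proof -
  have "\<forall>\<^sub>F t in at_right (0::real). t > 0"
    by (simp add: eventually_at_right_less)
  then show ?thesis
    using eventually_compose_filterlim[OF _ filterlim_snd] by (fastforce simp: case_prod_unfold)
qed

text \<open>A Lipschitz neighbourhood of \<open>z\<close> eventually contains both ends of the
  quotient. \<open>L\<close> is chosen before \<open>w\<close>: one constant for all directions is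
  what later bounds the Clarke gradient.\<close>

lemma clarke_quotient_bounded:
  assumes "locally_lipschitz \<psi>"
  obtains L where "\<And>w. \<forall>\<^sub>F (u, t) in nhds z \<times>\<^sub>F at_right 0.
      \<bar>(\<psi> (u + t *\<^sub>R w) - \<psi> u) / t\<bar> \<le> L * norm w"
proof -
  obtain U L where U: "open U" "z \<in> U"
    and L: "\<And>u1 u2. u1 \<in> U \<Longrightarrow> u2 \<in> U \<Longrightarrow> \<bar>\<psi> u1 - \<psi> u2\<bar> \<le> L * norm (u1 - u2)"
    using assms unfolding locally_lipschitz_def by meson
  have "\<forall>\<^sub>F (u, t) in nhds z \<times>\<^sub>F at_right 0. \<bar>(\<psi> (u + t *\<^sub>R w) - \<psi> u) / t\<bar> \<le> L * norm w" for w
  proof -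
    have "\<forall>\<^sub>F (u, t) in nhds z \<times>\<^sub>F at_right (0::real). u + t *\<^sub>R w \<in> U"
      using topological_tendstoD[OF filterlim_clarke_base U, of w] by (simp add: case_prod_unfold)
    \<comment> \<open>Direction 0 leaves the base point \<open>u\<close> itself.\<close>
    moreover have "\<forall>\<^sub>F (u, t) in nhds z \<times>\<^sub>F at_right (0::real). u \<in> U"
      using topological_tendstoD[OF filterlim_clarke_base U, of 0] by (simp add: case_prod_unfold)
    ultimately show ?thesis
      using eventually_clarke_pos
    proof eventually_elim
      case (elim x)
      obtain u t where x: "x = (u, t)" by force
      have "t > 0" and "\<bar>\<psi> (u + t *\<^sub>R w) - \<psi> u\<bar> \<le> L * norm (t *\<^sub>R w)"
        using elim L[of "u + t *\<^sub>R w" u] by (auto simp: x)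
      then show ?case
        by (simp add: x field_simps)
    qed
  qed
  then show thesis
    using that by blast
qed

text \<open>The quotient bound controls the Limsup from above and the Liminf from below. Liminf is
  at most Limsup because the filter is nontrivial, so the extended real value is finite and can be
  handled as a real function of the direction.\<close>

lemma clarke_dir_deriv_real:
  assumes "locally_lipschitz \<psi>"
  obtains p L where "\<And>w. clarke_dir_deriv \<psi> z w = ereal (p w)" "\<And>w. \<bar>p w\<bar> \<le> L * norm w"
proof -
  obtain L where L: "\<And>w. \<forall>\<^sub>F (u, t) in nhds z \<times>\<^sub>F at_right 0.
      \<bar>(\<psi> (u + t *\<^sub>R w) - \<psi> u) / t\<bar> \<le> L * norm w"
    using clarke_quotient_bounded[OF assms] by blast
  have ub: "clarke_dir_deriv \<psi> z w \<le> ereal (L * norm w)" for w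
  proof (rule clarke_dir_deriv_le)
    show "\<forall>\<^sub>F (u, t) in nhds z \<times>\<^sub>F at_right 0. (\<psi> (u + t *\<^sub>R w) - \<psi> u) / t \<le> L * norm w"
      using L[of w] by eventually_elim (auto simp del: abs_divide simp: abs_le_iff)
  qed
  have lb: "ereal (- (L * norm w)) \<le> clarke_dir_deriv \<psi> z w" for w
  proof -
    have "ereal (- (L * norm w))
        \<le> Liminf (nhds z \<times>\<^sub>F at_right 0) (\<lambda>(u, t). ereal ((\<psi> (u + t *\<^sub>R w) - \<psi> u) / t))"
    proof (rule Liminf_bounded)
      show "\<forall>\<^sub>F x in nhds z \<times>\<^sub>F at_right 0.
          ereal (- (L * norm w)) \<le> (case x of (u, t) \<Rightarrow> ereal ((\<psi> (u + t *\<^sub>R w) - \<psi> u) / t))"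
        using L[of w] by eventually_elim (auto simp del: abs_divide simp: abs_le_iff)
    qed
    also have "\<dots> \<le> clarke_dir_deriv \<psi> z w"
      unfolding clarke_dir_deriv_def by (rule Liminf_le_Limsup[OF nhds_at_right_neq_bot])
    finally show ?thesis .
  qed
  have eq: "clarke_dir_deriv \<psi> z w = ereal (real_of_ereal (clarke_dir_deriv \<psi> z w))" for w
    using ub[of w] lb[of w] by (cases "clarke_dir_deriv \<psi> z w") auto
  show thesis
  proof (rule that[OF eq])
    show "\<bar>real_of_ereal (clarke_dir_deriv \<psi> z w)\<bar> \<le> L * norm w" for w
      using ub[of w] lb[of w] by (cases "clarke_dir_deriv \<psi> z w") auto
  qed
qed

text \<open>The quotient along \<open>v + w\<close> from \<open>u\<close> is the quotient along
  \<open>v\<close> from \<open>u + t *\<^sub>R w\<close> plus the quotient along \<open>w\<close>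
  from \<open>u\<close>. The shifted base is harmless because the limes superior already ranges over
  all base points near \<open>z\<close>. Strict upper bounds are assumed since only these give
  eventual inequalities.\<close>

lemma clarke_dir_deriv_add:
  assumes v: "clarke_dir_deriv \<psi> z v < ereal a" and w: "clarke_dir_deriv \<psi> z w < ereal b"
  shows "clarke_dir_deriv \<psi> z (v + w) \<le> ereal (a + b)"
proof (rule clarke_dir_deriv_le)
  have "filterlim (\<lambda>(u, t). (u + t *\<^sub>R w, t)) (nhds z \<times>\<^sub>F at_right (0::real)) (nhds z \<times>\<^sub>F at_right 0)"
    using filterlim_Pair[OF filterlim_clarke_base[of w z] filterlim_snd]
    by (simp add: case_prod_unfold)
  from eventually_compose_filterlim[OF clarke_dir_deriv_lessD[OF v] this]
  have "\<forall>\<^sub>F (u, t) in nhds z \<times>\<^sub>F at_right 0. (\<psi> (u + t *\<^sub>R w + t *\<^sub>R v) - \<psi> (u + t *\<^sub>R w)) / t < a"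
    by (simp add: case_prod_unfold)
  then show "\<forall>\<^sub>F (u, t) in nhds z \<times>\<^sub>F at_right 0. (\<psi> (u + t *\<^sub>R (v + w)) - \<psi> u) / t \<le> a + b"
    using clarke_dir_deriv_lessD[OF w]
    by eventually_elim (auto simp: algebra_simps diff_divide_distrib)
qed

text \<open>Substitution of \<open>c * t\<close> for \<open>t\<close>, which preserves convergence
  to 0 from the right.\<close>

lemma clarke_dir_deriv_scaleR:
  assumes c: "c > 0" and w: "clarke_dir_deriv \<psi> z w < ereal a"
  shows "clarke_dir_deriv \<psi> z (c *\<^sub>R w) \<le> ereal (c * a)"
proof (rule clarke_dir_deriv_le)
  have "filterlim (\<lambda>t. c * t) (at_right 0) (at_right (0::real))"
    using c by real_asymp
  then have "filterlim (\<lambda>x. c * snd x) (at_right 0) (nhds z \<times>\<^sub>F at_right (0::real))"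
    by (rule filterlim_compose[OF _ filterlim_snd])
  from filterlim_Pair[OF filterlim_fst this]
  have "filterlim (\<lambda>x. (fst x, c * snd x)) (nhds z \<times>\<^sub>F at_right (0::real)) (nhds z \<times>\<^sub>F at_right 0)" .
  from eventually_compose_filterlim[OF clarke_dir_deriv_lessD[OF w] this]
  have "\<forall>\<^sub>F (u, t) in nhds z \<times>\<^sub>F at_right 0. (\<psi> (u + (c * t) *\<^sub>R w) - \<psi> u) / (c * t) < a"
    by (simp add: case_prod_unfold)
  then show "\<forall>\<^sub>F (u, t) in nhds z \<times>\<^sub>F at_right 0. (\<psi> (u + t *\<^sub>R c *\<^sub>R w) - \<psi> u) / t \<le> c * a"
    using eventually_clarke_pos
  proof eventually_elim
    case (elim x)
    obtain u t where x: "x = (u, t)" by force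
    show ?case
      using elim c by (simp add: x field_simps)
  qed
qed

section \<open>Supporting functionals and the geometry of the Clarke gradient\<close>

text \<open>A finite-dimensional Hahn--Banach theorem: separate \<open>(w, q w)\<close> from the strict epigraph of \<open>q\<close>.\<close>

lemma sublinear_supporting_functional:
  fixes q :: "'a::euclidean_space \<Rightarrow> real"
  assumes add: "\<And>v w. q (v + w) \<le> q v + q w"
    and scale: "\<And>c w. c > 0 \<Longrightarrow> q (c *\<^sub>R w) \<le> c * q w"
  obtains \<zeta> where "\<And>v. \<zeta> \<bullet> v \<le> q v" "\<zeta> \<bullet> w = q w"
proof -
  \<comment> \<open>The reverse inequality is homogeneity with factor \<open>inverse c\<close>
    applied to \<open>c *\<^sub>R v\<close>.\<close>
  have scale_eq: "q (c *\<^sub>R v) = c * q v" if "c > 0" for c v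
    using scale[OF that, of v] scale[of "inverse c" "c *\<^sub>R v"] that by (simp add: field_simps)
  have q0: "q 0 = 0"
    using scale_eq[of 2 0] by simp
  let ?E = "{(v, r). q v < r}"
  have "convex ?E"
    unfolding convex_alt
  proof (clarsimp)
    fix v r v' r' and s :: real
    assume a: "q v < r" "q v' < r'" "0 \<le> s" "s \<le> 1"
    show "q ((1 - s) *\<^sub>R v + s *\<^sub>R v') < (1 - s) * r + s * r'"
    proof (cases "s = 0 \<or> s = 1")
      case False
      then have "s > 0" "1 - s > 0"
        using a by auto
      then have "q ((1 - s) *\<^sub>R v + s *\<^sub>R v') \<le> (1 - s) * q v + s * q v'"
        using add[of "(1 - s) *\<^sub>R v" "s *\<^sub>R v'"] by (simp add: scale_eq)
      also have "\<dots> < (1 - s) * r + s * r'"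
        using a \<open>s > 0\<close> \<open>1 - s > 0\<close> by (intro add_strict_mono mult_strict_left_mono)
      finally show ?thesis .
    qed (use a in auto)
  qed
  moreover have "(0, 1) \<in> ?E"
    by (simp add: q0)
  ultimately obtain a b where ab: "a \<noteq> 0" "a \<bullet> (w, q w) \<le> b" "\<And>x. x \<in> ?E \<Longrightarrow> b \<le> a \<bullet> x"
    using separating_hyperplane_sets[of "{(w, q w)}" ?E] by fastforce
  obtain a1 a2 where a: "a = (a1, a2)" by force
  have sep: "a1 \<bullet> w + a2 * q w \<le> a1 \<bullet> v + a2 * r" if "q v < r" for v r
    using ab(2) ab(3)[of "(v, r)"] that by (simp add: a)
  \<comment> \<open>Compare with a point of the epigraph vertically above
    \<open>(w, q w)\<close>.\<close>
  have "0 \<le> a2"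
    using sep[of w "q w + 1"] by (simp add: algebra_simps)
  \<comment> \<open>A vertical hyperplane is impossible because \<open>q\<close> is finite in every
    direction: moving from \<open>w\<close> by \<open>- a1\<close> would force
    \<open>a1 = 0\<close>.\<close>
  moreover have "a2 \<noteq> 0"
  proof
    assume "a2 = 0"
    then have "a1 \<bullet> w \<le> a1 \<bullet> v" for v
      using sep[of v "q v + 1"] by simp
    from this[of "w - a1"] have "a1 \<bullet> a1 \<le> 0"
      by (simp add: inner_diff_right)
    then have "a1 = 0"
      by (metis inner_gt_zero_iff not_less)
    then show False
      using ab(1) \<open>a2 = 0\<close> by (simp add: a zero_prod_def)
  qed
  ultimately have a2: "a2 > 0" by simp
  \<comment> \<open>The slope of the separating hyperplane, that is, a subgradient of
    \<open>q\<close> at \<open>w\<close>.\<close>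
  define \<zeta> where "\<zeta> = - (1 / a2) *\<^sub>R a1"
  have sep': "\<zeta> \<bullet> v - q v \<le> \<zeta> \<bullet> w - q w" for v
  proof -
    have "\<zeta> \<bullet> v - \<zeta> \<bullet> w + q w \<le> r" if "q v < r" for r
      using sep[OF that] a2 by (simp add: \<zeta>_def field_simps)
    then have "\<zeta> \<bullet> v - \<zeta> \<bullet> w + q w \<le> q v"
      by (rule dense_ge)
    then show ?thesis by simp
  qed
  \<comment> \<open>The gap \<open>\<zeta> \<bullet> w - q w\<close> is nonnegative by testing 0,
    and nonpositive by testing \<open>2 *\<^sub>R w\<close>, where homogeneity doubles it.\<close>
  have "\<zeta> \<bullet> w = q w"
    using sep'[of 0] sep'[of "2 *\<^sub>R w"] scale_eq[of 2 w] q0 by simp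
  then show thesis
    using sep' by (intro that[of \<zeta>]) auto
qed

text \<open>The Clarke derivative is a finite sublinear function of the direction, and a linear
  functional below it is exactly an element of the Clarke gradient. Hence the derivative is the
  support function of the gradient, with the supremum attained.\<close>

lemma clarke_gradient_attains:
  fixes z w :: "'a::euclidean_space"
  assumes "locally_lipschitz \<psi>"
  obtains \<zeta> where "\<zeta> \<in> clarke_gradient \<psi> z" "clarke_dir_deriv \<psi> z w = ereal (\<zeta> \<bullet> w)"
proof -
  obtain q L where q: "\<And>w. clarke_dir_deriv \<psi> z w = ereal (q w)"
    using clarke_dir_deriv_real[OF assms] by blast
  \<comment> \<open>The slack \<open>e\<close> supplies the strict bounds that the calculus rules
    require.\<close>
  have "q (v + w) \<le> q v + q w" for v w
  proof (rule field_le_epsilon)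
    fix e :: real assume "e > 0"
    then show "q (v + w) \<le> q v + q w + e"
      using clarke_dir_deriv_add[of \<psi> z v "q v + e/2" w "q w + e/2"] by (simp add: q)
  qed
  moreover have "q (c *\<^sub>R w) \<le> c * q w" if "c > 0" for c w
  proof (rule field_le_epsilon)
    fix e :: real assume "e > 0"
    then show "q (c *\<^sub>R w) \<le> c * q w + e"
      using clarke_dir_deriv_scaleR[of c \<psi> z w "q w + e/c"] that by (simp add: q distrib_left)
  qed
  ultimately obtain \<zeta> where "\<And>v. \<zeta> \<bullet> v \<le> q v" "\<zeta> \<bullet> w = q w"
    using sublinear_supporting_functional by metis
  then show thesis
    by (intro that[of \<zeta>]) (auto simp: clarke_gradient_def q)
qed

lemma clarke_gradient_nonempty:
  fixes z :: "'a::euclidean_space"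
  assumes "locally_lipschitz \<psi>"
  shows "clarke_gradient \<psi> z \<noteq> {}"
  using clarke_gradient_attains[OF assms] by blast

lemma convex_clarke_gradient:
  fixes z :: "'a::euclidean_space"
  assumes "locally_lipschitz \<psi>"
  shows "convex (clarke_gradient \<psi> z)"
proof -
  obtain q L where q: "\<And>w. clarke_dir_deriv \<psi> z w = ereal (q w)"
    using clarke_dir_deriv_real[OF assms] by blast
  have "clarke_gradient \<psi> z = (\<Inter>w. {\<zeta>. w \<bullet> \<zeta> \<le> q w})"
    by (auto simp: clarke_gradient_def q inner_commute)
  then show ?thesis
    by (simp add: convex_INT convex_halfspace_le)
qed

text \<open>Closed as an intersection of half-spaces; bounded because testing an element
  \<open>\<zeta>\<close> in its own direction gives
  \<open>norm \<zeta> * norm \<zeta> \<le> L * norm \<zeta>\<close>.\<close>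

lemma compact_clarke_gradient:
  fixes z :: "'a::euclidean_space"
  assumes "locally_lipschitz \<psi>"
  shows "compact (clarke_gradient \<psi> z)"
proof -
  obtain q L where q: "\<And>w. clarke_dir_deriv \<psi> z w = ereal (q w)" and L: "\<And>w. \<bar>q w\<bar> \<le> L * norm w"
    using clarke_dir_deriv_real[OF assms] by blast
  have eq: "clarke_gradient \<psi> z = (\<Inter>w. {\<zeta>. w \<bullet> \<zeta> \<le> q w})"
    by (auto simp: clarke_gradient_def q inner_commute)
  have "norm \<zeta> \<le> \<bar>L\<bar>" if "\<zeta> \<in> clarke_gradient \<psi> z" for \<zeta>
  proof (cases "\<zeta> = 0")
    case False
    have "norm \<zeta> * norm \<zeta> = \<zeta> \<bullet> \<zeta>"
      by (simp add: norm_eq_sqrt_inner)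
    also have "\<dots> \<le> L * norm \<zeta>"
      using that L[of \<zeta>] by (fastforce simp: eq intro: order_trans)
    finally show ?thesis
      using False by simp
  qed simp
  then have "bounded (clarke_gradient \<psi> z)"
    by (auto simp: bounded_iff)
  moreover have "closed (clarke_gradient \<psi> z)"
    unfolding eq by (intro closed_INT ballI closed_halfspace_le)
  ultimately show ?thesis
    by (simp add: compact_eq_bounded_closed)
qed

section \<open>From the absence of common descent to 0 in the hull of the gradients\<close>

text \<open>Freezing the base point at \<open>z\<close> turns the bound on the limes superior into
  one on the ordinary right-hand difference quotient.\<close>

lemma clarke_descent:
  assumes "clarke_dir_deriv \<psi> z w < 0"
  shows "\<forall>\<^sub>F t in at_right 0. \<psi> (z + t *\<^sub>R w) < \<psi> z"
proof -
  have "filterlim (\<lambda>t. (z, t)) (nhds z \<times>\<^sub>F at_right (0::real)) (at_right 0)"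
    by (intro filterlim_Pair tendsto_const filterlim_ident)
  from eventually_compose_filterlim[OF clarke_dir_deriv_lessD this, of \<psi> w 0]
  have "\<forall>\<^sub>F t in at_right 0. (\<psi> (z + t *\<^sub>R w) - \<psi> z) / t < 0"
    using assms by (simp add: zero_ereal_def)
  moreover have "\<forall>\<^sub>F t in at_right (0::real). t > 0"
    by (simp add: eventually_at_right_less)
  ultimately show ?thesis
    by eventually_elim (simp add: divide_less_0_iff)
qed

lemma zero_in_hull_clarke_gradients:
  fixes z :: "'a::euclidean_space"
  assumes fin: "finite \<Psi>" and lip: "\<And>\<psi>. \<psi> \<in> \<Psi> \<Longrightarrow> locally_lipschitz \<psi>"
    and no_descent: "\<forall>\<^sub>F u in nhds z. \<exists>\<psi>\<in>\<Psi>. \<psi> z \<le> \<psi> u"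
  shows "0 \<in> convex hull (\<Union>\<psi>\<in>\<Psi>. clarke_gradient \<psi> z)" (is "0 \<in> convex hull ?G")
proof (rule ccontr)
  assume nz: "0 \<notin> convex hull ?G"
  \<comment> \<open>Compactness makes the separation from 0 strict; it rests on the finiteness of
    the family.\<close>
  have "compact (convex hull ?G)"
    using fin lip by (intro compact_convex_hull compact_UN) (auto simp: compact_clarke_gradient)
  then obtain w b where b: "0 < b" "\<And>\<zeta>. \<zeta> \<in> convex hull ?G \<Longrightarrow> w \<bullet> \<zeta> > b"
    using separating_hyperplane_closed_0[OF convex_convex_hull compact_imp_closed nz] by blast
  \<comment> \<open>The derivative along \<open>- w\<close> is attained at some
    \<open>\<zeta>\<close> of the gradient, and the separation makes
    \<open>\<zeta> \<bullet> (- w)\<close> less than \<open>- b\<close>.\<close>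
  have "\<forall>\<^sub>F t in at_right 0. \<psi> (z + t *\<^sub>R - w) < \<psi> z" if \<psi>: "\<psi> \<in> \<Psi>" for \<psi>
  proof (rule clarke_descent)
    obtain \<zeta> where \<zeta>: "\<zeta> \<in> clarke_gradient \<psi> z" "clarke_dir_deriv \<psi> z (- w) = ereal (\<zeta> \<bullet> (- w))"
      using clarke_gradient_attains[OF lip[OF \<psi>]] by blast
    then have "w \<bullet> \<zeta> > b"
      using \<psi> by (intro b(2) hull_inc) auto
    then show "clarke_dir_deriv \<psi> z (- w) < 0"
      using b(1) \<zeta>(2) by (simp add: inner_commute zero_ereal_def)
  qed
  then have "\<forall>\<^sub>F t in at_right 0. \<forall>\<psi>\<in>\<Psi>. \<psi> (z + t *\<^sub>R - w) < \<psi> z"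
    using fin by (simp add: eventually_ball_finite)
  moreover have "((\<lambda>t. z + t *\<^sub>R - w) \<longlongrightarrow> z + 0 *\<^sub>R - w) (at_right 0)"
    by (intro tendsto_intros)
  then have "\<forall>\<^sub>F t in at_right 0. \<exists>\<psi>\<in>\<Psi>. \<psi> z \<le> \<psi> (z + t *\<^sub>R - w)"
    using eventually_compose_filterlim[OF no_descent] by simp
  ultimately have "\<forall>\<^sub>F t in at_right (0::real). False"
    by eventually_elim force
  then show False
    by simp
qed

section \<open>Interval-valued objectives and the Fritz John rule\<close>

lemma locally_lipschitz_center_halfwidth:
  assumes "locally_lipschitz_interval f"
  shows "locally_lipschitz (\<lambda>x. center (f x))" "locally_lipschitz (\<lambda>x. halfwidth (f x))"
proof -
  have "\<exists>U L. open U \<and> x \<in> U \<and> L > 0 \<and> (\<forall>u\<in>U. \<forall>v\<in>U.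
      \<bar>center (f u) - center (f v)\<bar> \<le> L * norm (u - v) \<and>
      \<bar>halfwidth (f u) - halfwidth (f v)\<bar> \<le> L * norm (u - v))" for x
  proof -
    obtain U L where U: "open U" "x \<in> U" "L > 0"
      and L: "\<And>u v. u \<in> U \<Longrightarrow> v \<in> U \<Longrightarrow>
        max \<bar>lower (f u) - lower (f v)\<bar> \<bar>upper (f u) - upper (f v)\<bar> \<le> L * norm (u - v)"
      using assms unfolding locally_lipschitz_interval_def by meson
    have "\<bar>center (f u) - center (f v)\<bar> \<le> L * norm (u - v) \<and>
        \<bar>halfwidth (f u) - halfwidth (f v)\<bar> \<le> L * norm (u - v)" if "u \<in> U" "v \<in> U" for u v
      using L[OF that] by (auto simp: center_def halfwidth_def abs_le_iff field_simps)
    with U show ?thesis by blast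
  qed
  then show "locally_lipschitz (\<lambda>x. center (f x))" "locally_lipschitz (\<lambda>x. halfwidth (f x))"
    unfolding locally_lipschitz_def by meson+
qed

lemma weak_gen_gradient_nonempty:
  fixes z :: "'a::euclidean_space"
  assumes "locally_lipschitz_interval f"
  shows "weak_gen_gradient f z \<noteq> {}"
  using clarke_gradient_nonempty[OF locally_lipschitz_center_halfwidth(1)[OF assms], of z]
  by (simp add: weak_gen_gradient_def)

lemma locally_lipschitz_isCont:
  assumes "locally_lipschitz \<psi>"
  shows "isCont \<psi> z"
proof -
  obtain U L where U: "open U" "z \<in> U"
    and L: "\<And>u1 u2. u1 \<in> U \<Longrightarrow> u2 \<in> U \<Longrightarrow> \<bar>\<psi> u1 - \<psi> u2\<bar> \<le> L * norm (u1 - u2)"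
    using assms unfolding locally_lipschitz_def by meson
  have "((\<lambda>u. L * norm (u - z)) \<longlongrightarrow> L * norm (z - z)) (at z)"
    by (intro tendsto_intros)
  then have lim: "((\<lambda>u. L * norm (u - z)) \<longlongrightarrow> 0) (at z)"
    by simp
  have "\<forall>\<^sub>F u in at z. norm (\<psi> u - \<psi> z) \<le> L * norm (u - z)"
    using eventually_at_in_open'[OF U] by eventually_elim (use L U in auto)
  then have "((\<lambda>u. \<psi> u - \<psi> z) \<longlongrightarrow> 0) (at z)"
    using lim by (rule Lim_null_comparison)
  then show ?thesis
    by (simp add: isCont_def LIM_zero_iff)
qed

text \<open>Near \<open>z\<close> the inactive constraints stay negative by continuity. A nearby
  point lowering all centres, half-widths and active constraints strictly would thus be feasible and
  dominate \<open>z\<close>, so these functions have no common descent.\<close>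

lemma weak_minimal_zero_in_hull:
  fixes z :: "'a::euclidean_space"
  assumes F_lip: "\<And>k. k \<in> {1..m} \<Longrightarrow> locally_lipschitz_interval (F k)"
    and g_lip: "\<And>j. j \<in> {1..p} \<Longrightarrow> locally_lipschitz (g j)"
    and minimal: "locally_weak_minimal m F (feasible_set p g) z"
  shows "0 \<in> convex hull ((\<Union>k\<in>{1..m}. weak_gen_gradient (F k) z) \<union>
           (\<Union>j\<in>active_set p g z. clarke_gradient (g j) z))" (is "0 \<in> convex hull ?H")
proof -
  define C where "C = (\<lambda>k x. center (F k x)) ` {1..m}"
  define W where "W = (\<lambda>k x. halfwidth (F k x)) ` {1..m}"
  define A where "A = g ` active_set p g z"
  obtain U where U: "open U" "z \<in> U" and zS: "z \<in> feasible_set p g"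
    and noz: "\<And>u. u \<in> feasible_set p g \<inter> U \<Longrightarrow> \<exists>k\<in>{1..m}. \<not> F k u \<prec>\<^sub>C\<^sub>W F k z"
    using minimal unfolding locally_weak_minimal_def by blast
  have "\<forall>\<^sub>F u in nhds z. g j u < 0" if "j \<in> {1..p} - active_set p g z" for j
  proof -
    have "g j z < 0"
      using that zS by (force simp: active_set_def feasible_set_def)
    moreover have "(g j \<longlongrightarrow> g j z) (nhds z)"
      using locally_lipschitz_isCont[OF g_lip] that by (simp add: tendsto_nhds_iff isCont_def)
    ultimately show ?thesis
      by (rule order_tendstoD(2)[rotated])
  qed
  then have inact: "\<forall>\<^sub>F u in nhds z. \<forall>j\<in>{1..p} - active_set p g z. g j u < 0"
    by (simp add: eventually_ball_finite)
  have "\<forall>\<^sub>F u in nhds z. \<exists>\<psi>\<in>C \<union> W \<union> A. \<psi> z \<le> \<psi> u"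
    using inact eventually_nhds_in_open[OF U]
  proof eventually_elim
    case (elim u)
    show ?case
    proof (rule ccontr)
      assume "\<not> ?thesis"
      then have less: "\<psi> u < \<psi> z" if "\<psi> \<in> C \<union> W \<union> A" for \<psi>
        using that by (meson not_le)
      have "g j u \<le> 0" if "j \<in> {1..p}" for j
      proof (cases "j \<in> active_set p g z")
        case True
        then show ?thesis
          using less[of "g j"] by (auto simp: A_def active_set_def)
      qed (use elim that in force)
      then have "u \<in> feasible_set p g \<inter> U"
        using elim by (simp add: feasible_set_def)
      then obtain k where k: "k \<in> {1..m}" "\<not> F k u \<prec>\<^sub>C\<^sub>W F k z"
        using noz by blast
      then show False
        using less[of "\<lambda>x. center (F k x)"] less[of "\<lambda>x. halfwidth (F k x)"]
        by (auto simp: C_def W_def less_CW_def)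
    qed
  qed
  moreover have "finite (C \<union> W \<union> A)"
    by (simp add: C_def W_def A_def active_set_def)
  moreover have "locally_lipschitz \<psi>" if "\<psi> \<in> C \<union> W \<union> A" for \<psi>
    using that locally_lipschitz_center_halfwidth[OF F_lip] g_lip
    by (auto simp: C_def W_def A_def active_set_def)
  ultimately have "0 \<in> convex hull (\<Union>\<psi>\<in>C \<union> W \<union> A. clarke_gradient \<psi> z)"
    by (rule zero_in_hull_clarke_gradients[rotated 2])
  \<comment> \<open>Each weak gradient contains the two Clarke gradients that generate it.\<close>
  moreover have "(\<Union>\<psi>\<in>C \<union> W \<union> A. clarke_gradient \<psi> z) \<subseteq> ?H"
    unfolding C_def W_def A_def weak_gen_gradient_def by (blast intro: hull_inc)
  ultimately show ?thesis
    using hull_mono by blast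
qed

text \<open>All the sets involved are convex and nonempty, so a convex combination from their union
  can be regrouped into one representative and one weight per set.\<close>

lemma weak_minimal_fritz_john:
  fixes z :: "'a::euclidean_space"
  assumes F_lip: "\<And>k. k \<in> {1..m} \<Longrightarrow> locally_lipschitz_interval (F k)"
    and g_lip: "\<And>j. j \<in> {1..p} \<Longrightarrow> locally_lipschitz (g j)"
    and minimal: "locally_weak_minimal m F (feasible_set p g) z"
  obtains u v and lam \<mu> :: "nat \<Rightarrow> real"
  where "\<And>k. k \<in> {1..m} \<Longrightarrow> u k \<in> weak_gen_gradient (F k) z"
    and "\<And>j. j \<in> {1..p} \<Longrightarrow> v j \<in> clarke_gradient (g j) z"
    and "\<And>k. k \<in> {1..m} \<Longrightarrow> lam k \<ge> 0"
    and "\<And>j. j \<in> {1..p} \<Longrightarrow> \<mu> j \<ge> 0"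
    and "\<And>j. j \<in> {1..p} - active_set p g z \<Longrightarrow> \<mu> j = 0"
    and "(\<Sum>k=1..m. lam k) + (\<Sum>j=1..p. \<mu> j) = 1"
    and "(\<Sum>k=1..m. lam k *\<^sub>R u k) + (\<Sum>j=1..p. \<mu> j *\<^sub>R v j) = 0"
proof -
  define A where "A = active_set p g z"
  have A: "A \<subseteq> {1..p}" "finite A"
    by (auto simp: A_def active_set_def)
  \<comment> \<open>The disjoint sum merges objectives and active constraints into a single indexed
    family.\<close>
  define T where "T = case_sum (\<lambda>k. weak_gen_gradient (F k) z) (\<lambda>j. clarke_gradient (g j) z)"
  have "(\<Union>k\<in>{1..m}. weak_gen_gradient (F k) z) \<union> (\<Union>j\<in>A. clarke_gradient (g j) z)
      = \<Union> (T ` ({1..m} <+> A))"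
    by (auto simp: T_def)
  then have "0 \<in> convex hull (\<Union> (T ` ({1..m} <+> A)))"
    using weak_minimal_zero_in_hull[OF F_lip g_lip minimal] by (simp add: A_def)
  moreover have "convex (T i) \<and> T i \<noteq> {}" if "i \<in> {1..m} <+> A" for i
    using that A weak_gen_gradient_nonempty[OF F_lip] clarke_gradient_nonempty[OF g_lip]
      convex_clarke_gradient[OF g_lip]
    by (auto simp: T_def weak_gen_gradient_def)
  ultimately obtain c s where c: "\<forall>i\<in>{1..m} <+> A. 0 \<le> c i" "sum c ({1..m} <+> A) = 1"
    and s: "\<forall>i\<in>{1..m} <+> A. s i \<in> T i" "(\<Sum>i\<in>{1..m} <+> A. c i *\<^sub>R s i) = 0"
    using A by (subst (asm) convex_hull_finite_union) auto
  \<comment> \<open>Inactive constraints also need a representative; it is arbitrary, as its weight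
    will be 0.\<close>
  obtain v0 where v0: "\<And>j. j \<in> {1..p} \<Longrightarrow> v0 j \<in> clarke_gradient (g j) z"
    using bchoice[of "{1..p}" "\<lambda>j \<zeta>. \<zeta> \<in> clarke_gradient (g j) z"]
      clarke_gradient_nonempty[OF g_lip] by (metis ex_in_conv)
  define v where "v j = (if j \<in> A then s (Inr j) else v0 j)" for j
  define \<mu> where "\<mu> j = (if j \<in> A then c (Inr j) else 0)" for j
  show thesis
  proof (rule that[of "\<lambda>k. s (Inl k)" v "\<lambda>k. c (Inl k)" \<mu>])
    have "(\<Sum>j=1..p. \<mu> j) = (\<Sum>j\<in>A. c (Inr j))"
      using A by (intro sum.mono_neutral_cong_right) (auto simp: \<mu>_def)
    then show "(\<Sum>k=1..m. c (Inl k)) + (\<Sum>j=1..p. \<mu> j) = 1"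
      using c(2) A by (simp add: sum.Plus)
    have "(\<Sum>j=1..p. \<mu> j *\<^sub>R v j) = (\<Sum>j\<in>A. c (Inr j) *\<^sub>R s (Inr j))"
      using A by (intro sum.mono_neutral_cong_right) (auto simp: \<mu>_def v_def)
    then show "(\<Sum>k=1..m. c (Inl k) *\<^sub>R s (Inl k)) + (\<Sum>j=1..p. \<mu> j *\<^sub>R v j) = 0"
      using s(2) A by (simp add: sum.Plus)
  qed (use c(1) s(1) v0 in \<open>force simp: T_def \<mu>_def v_def A_def\<close>)+
qed

section \<open>BCQ and normalised multipliers\<close>

lemma weak_minimal_kkt:
  fixes z :: "'a::euclidean_space"
  assumes F_lip: "\<And>k. k \<in> {1..m} \<Longrightarrow> locally_lipschitz_interval (F k)"
    and g_lip: "\<And>j. j \<in> {1..p} \<Longrightarrow> locally_lipschitz (g j)"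
    and minimal: "locally_weak_minimal m F (feasible_set p g) z"
    and bcq: "BCQ p g z"
  obtains u v and lam \<mu> :: "nat \<Rightarrow> real"
  where "\<And>k. k \<in> {1..m} \<Longrightarrow> u k \<in> weak_gen_gradient (F k) z"
    and "\<And>j. j \<in> {1..p} \<Longrightarrow> v j \<in> clarke_gradient (g j) z"
    and "\<And>k. k \<in> {1..m} \<Longrightarrow> lam k \<ge> 0" and "(\<Sum>k=1..m. lam k) = 1"
    and "\<And>j. j \<in> {1..p} \<Longrightarrow> \<mu> j \<ge> 0"
    and "(\<Sum>k=1..m. lam k *\<^sub>R u k) + (\<Sum>j=1..p. \<mu> j *\<^sub>R v j) = 0"
    and "(\<Sum>j=1..p. \<mu> j * g j z) = 0"
proof -
  obtain u v and lam \<mu> :: "nat \<Rightarrow> real"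
    where u: "\<And>k. k \<in> {1..m} \<Longrightarrow> u k \<in> weak_gen_gradient (F k) z"
      and v: "\<And>j. j \<in> {1..p} \<Longrightarrow> v j \<in> clarke_gradient (g j) z"
      and lam: "\<And>k. k \<in> {1..m} \<Longrightarrow> lam k \<ge> 0"
      and \<mu>: "\<And>j. j \<in> {1..p} \<Longrightarrow> \<mu> j \<ge> 0"
      and inact: "\<And>j. j \<in> {1..p} - active_set p g z \<Longrightarrow> \<mu> j = 0"
      and total: "(\<Sum>k=1..m. lam k) + (\<Sum>j=1..p. \<mu> j) = 1"
      and zero: "(\<Sum>k=1..m. lam k *\<^sub>R u k) + (\<Sum>j=1..p. \<mu> j *\<^sub>R v j) = 0"
    using weak_minimal_fritz_john[OF F_lip g_lip minimal] by blast
  define \<Lambda> where "\<Lambda> = (\<Sum>k=1..m. lam k)"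
  \<comment> \<open>If the objectives had no weight, the constraint multipliers would have sum 1 and
    would annihilate a selection of gradients, against BCQ.\<close>
  have "\<Lambda> \<noteq> 0"
  proof
    assume 0: "\<Lambda> = 0"
    then have "lam k = 0" if "k \<in> {1..m}" for k
      using that lam by (metis (no_types, lifting) \<Lambda>_def finite_atLeastAtMost sum_nonneg_eq_0_iff)
    then have "(\<Sum>j=1..p. \<mu> j *\<^sub>R v j) = 0"
      using zero by simp
    then have "0 \<in> (\<Sum>j\<in>{1..p}. (\<lambda>v. \<mu> j *\<^sub>R v) ` clarke_gradient (g j) z)"
      using v by (subst set_sum_alt) (force intro: exI[of _ "\<lambda>j. \<mu> j *\<^sub>R v j"])+
    moreover have "\<exists>j\<in>{1..p}. \<mu> j \<noteq> 0"
      using total 0 unfolding \<Lambda>_def by (metis add_0 sum.neutral zero_neq_one)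
    moreover have "\<forall>j\<in>active_set p g z. \<mu> j \<ge> 0"
      using \<mu> by (simp add: active_set_def)
    ultimately show False
      using bcq inact unfolding BCQ_def by blast
  qed
  moreover have "\<Lambda> \<ge> 0"
    unfolding \<Lambda>_def using lam by (rule sum_nonneg)
  ultimately have \<Lambda>: "\<Lambda> > 0" by simp
  show thesis
  proof (rule that[of u v "\<lambda>k. lam k / \<Lambda>" "\<lambda>j. \<mu> j / \<Lambda>"])
    show "(\<Sum>k=1..m. lam k / \<Lambda>) = 1"
      using \<Lambda> by (simp add: \<Lambda>_def flip: sum_divide_distrib)
    have "(\<Sum>k=1..m. (lam k / \<Lambda>) *\<^sub>R u k) + (\<Sum>j=1..p. (\<mu> j / \<Lambda>) *\<^sub>R v j)
        = (1 / \<Lambda>) *\<^sub>R ((\<Sum>k=1..m. lam k *\<^sub>R u k) + (\<Sum>j=1..p. \<mu> j *\<^sub>R v j))"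
      by (simp add: scaleR_add_right scaleR_sum_right)
    then show "(\<Sum>k=1..m. (lam k / \<Lambda>) *\<^sub>R u k) + (\<Sum>j=1..p. (\<mu> j / \<Lambda>) *\<^sub>R v j) = 0"
      by (simp only: zero scaleR_zero_right)
    \<comment> \<open>Every summand vanishes: \<open>g j z\<close> is 0 for active \<open>j\<close>,
      \<open>\<mu> j\<close> is 0 otherwise.\<close>
    show "(\<Sum>j=1..p. \<mu> j / \<Lambda> * g j z) = 0"
      using inact by (intro sum.neutral) (force simp: active_set_def)
  qed (use u v lam \<mu> \<Lambda> in auto)
qed

section \<open>Choice of the subsequence and conclusion\<close>

text \<open>Each index is picked beyond the previous one and late enough for its own property. This
  matches the \<open>i\<close>-th term of the subsequence with the \<open>i\<close>-th tolerance
  rather than with the tolerance at \<open>r i\<close>.\<close>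

lemma strict_mono_diagonal:
  fixes P :: "nat \<Rightarrow> nat \<Rightarrow> bool"
  assumes "\<And>i. \<forall>\<^sub>F n in sequentially. P i n"
  obtains r where "strict_mono r" "\<And>i. P i (r i)"
proof -
  have "\<exists>r. \<forall>i. P i (r i) \<and> r i < r (Suc i)"
  proof (rule dependent_nat_choice)
    show "\<exists>n. P 0 n"
      using eventually_happens[OF assms[of 0]] by simp
    show "\<exists>n'. P (Suc i) n' \<and> n < n'" for n i
      using eventually_happens[OF eventually_conj[OF assms[of "Suc i"] eventually_gt_at_top[of n]]]
      by simp
  qed
  then show thesis
    using that by (auto simp: strict_mono_Suc_iff)
qed

theorem theorem4p4:
  fixes m p :: nat
    and F :: "nat \<Rightarrow> real ^ 'n \<Rightarrow> real interval"
    and g :: "nat \<Rightarrow> real ^ 'n \<Rightarrow> real"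
    and S :: "(real ^ 'n) set"
    and ubar :: "real ^ 'n"
    and \<epsilon> :: "nat \<Rightarrow> real"
    and x :: "nat \<Rightarrow> real ^ 'n"
  assumes F_lip: "\<And>k. k \<in> {1..m} \<Longrightarrow> locally_lipschitz_interval (F k)"
    and g_lip: "\<And>j. j \<in> {1..p} \<Longrightarrow> locally_lipschitz (g j)"
    and S_def: "S = feasible_set p g"
    and minimal: "locally_weak_minimal m F S ubar"
    and bcq: "\<exists>N. open N \<and> ubar \<in> N \<and> (\<forall>u\<in>S \<inter> N. BCQ p g u)"
    and eps_pos: "\<And>i. \<epsilon> i > 0"
    and eps_lim: "\<epsilon> \<longlonglongrightarrow> 0"
    and x_in: "\<And>i. x i \<in> S"
    and x_lim: "x \<longlonglongrightarrow> ubar"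
  shows "\<exists>r :: nat \<Rightarrow> nat. strict_mono r \<and>
    (\<forall>i. \<exists>y\<in>S.
       norm (x (r i) - y) \<le> sqrt (\<epsilon> i) \<and>
       (\<exists>(u :: nat \<Rightarrow> real ^ 'n) (v :: nat \<Rightarrow> real ^ 'n) (lam :: nat \<Rightarrow> real) (\<mu> :: nat \<Rightarrow> real).
          (\<forall>k\<in>{1..m}. u k \<in> weak_gen_gradient (F k) y) \<and>
          (\<forall>j\<in>{1..p}. v j \<in> clarke_gradient (g j) y) \<and>
          (\<forall>k\<in>{1..m}. lam k \<ge> 0) \<and> (\<Sum>k=1..m. lam k) = 1 \<and>
          (\<forall>j\<in>{1..p}. \<mu> j \<ge> 0) \<and>
          norm ((\<Sum>k=1..m. lam k *\<^sub>R u k) + (\<Sum>j=1..p. \<mu> j *\<^sub>R v j)) \<le> sqrt (\<epsilon> i) \<and>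
          (\<Sum>j=1..p. \<mu> j * g j y) = 0))"
proof -
  have min: "locally_weak_minimal m F (feasible_set p g) ubar"
    using minimal by (simp add: S_def)
  have ubar: "ubar \<in> S"
    using minimal by (simp add: locally_weak_minimal_def)
  with bcq have "BCQ p g ubar"
    by blast
  then obtain u v and lam \<mu> :: "nat \<Rightarrow> real"
    where "\<And>k. k \<in> {1..m} \<Longrightarrow> u k \<in> weak_gen_gradient (F k) ubar"
      and "\<And>j. j \<in> {1..p} \<Longrightarrow> v j \<in> clarke_gradient (g j) ubar"
      and "\<And>k. k \<in> {1..m} \<Longrightarrow> lam k \<ge> 0" and "(\<Sum>k=1..m. lam k) = 1"
      and "\<And>j. j \<in> {1..p} \<Longrightarrow> \<mu> j \<ge> 0"
      and "(\<Sum>k=1..m. lam k *\<^sub>R u k) + (\<Sum>j=1..p. \<mu> j *\<^sub>R v j) = 0"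
      and "(\<Sum>j=1..p. \<mu> j * g j ubar) = 0"
    using weak_minimal_kkt[OF F_lip g_lip min] by blast
  note kkt = this
  \<comment> \<open>For fixed \<open>i\<close> the tolerance \<open>sqrt (\<epsilon> i)\<close> is a
    positive constant, so convergence of \<open>x\<close> covers a whole tail.\<close>
  have "\<forall>\<^sub>F n in sequentially. norm (x n - ubar) \<le> sqrt (\<epsilon> i)" for i
    using tendstoD[OF x_lim, of "sqrt (\<epsilon> i)"] eps_pos[of i]
    by (auto simp: dist_norm elim: eventually_mono)
  then obtain r where r: "strict_mono r" "\<And>i. norm (x (r i) - ubar) \<le> sqrt (\<epsilon> i)"
    using strict_mono_diagonal[of "\<lambda>i n. norm (x n - ubar) \<le> sqrt (\<epsilon> i)"] by blast
  have "norm ((\<Sum>k=1..m. lam k *\<^sub>R u k) + (\<Sum>j=1..p. \<mu> j *\<^sub>R v j)) \<le> sqrt (\<epsilon> i)" for i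
    using kkt(6) eps_pos[of i] by simp
  \<comment> \<open>The point \<open>ubar\<close> and one fixed choice of gradients and multipliers
    serve for every \<open>i\<close>.\<close>
  then show ?thesis
    using r ubar kkt(1-5,7)
    by (intro exI[of _ r] conjI allI bexI[of _ ubar] exI[of _ u] exI[of _ v] exI[of _ lam] exI[of _ \<mu>]) auto
qed

end
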